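(* The mapping $\phi:\mathcal{C}_A\to\mathcal{G}_A$, $\phi(b):=Q_{A,b}$, is a homeomorphism between $(\mathcal{C}_A,\|\cdot\|_\infty)$ and $(\mathcal{G}_A,\mathrm{dist}_H)$. The mapping $\phi$ is $L_A$-Lipschitz, and its inverse $\phi^{-1}$ is $1$-Lipschitz.
   Context: Let $A\in\mathbb{R}^{N\times d}$ be a fixed matrix whose rows $a_1^T,\ldots,a_N^T$ are pairwise distinct and satisfy $\|a_i\|_2=1$ for $i=1,\ldots,N$. For $b\in\mathbb{R}^N$ put $Q_{A,b}:=\{x\in\mathbb{R}^d: Ax\le b\}$ (componentwise inequality). Set $\mathcal{G}_A:=\{Q_{A,b}:b\in\mathbb{R}^N\}\setminus\{\emptyset\}$ and $$\mathcal{C}_A:=\{b\in\mathbb{R}^N:\ \forall\, i\in\{1,\ldots,N\}\ \exists\, x_i\in Q_{A,b}\ \text{with}\ a_i^Tx_i=b_i\}.$$ For nonempty closed convex sets $C,\tilde C\subset\mathbb{R}^d$ (possibly unbounded) put $\mathrm{dist}(C,\tilde C):=\sup_{c\in C}\inf_{\tilde c\in\tilde C}\|c-\tilde c\|_2$ and $\mathrm{dist}_H(C,\tilde C):=\max\{\mathrm{dist}(C,\tilde C),\mathrm{dist}(\tilde C,C)\}$. The number $L_A\ge 0$ is a constant (which exists by Hoffman's error bound) such that for all $x\in\mathbb{R}^d$ and all $b\in\mathbb{R}^N$ with $Q_{A,b}\ne\emptyset$ one has $\inf_{y\in Q_{A,b}}\|x-y\|_2\le L_A\|\max\{0,Ax-b\}\|_\infty$,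 where the maximum is taken componentwise. *)

theory Defs
  imports "HOL-Analysis.Analysis"
begin

definition poly_Q :: "real^'d^'n \<Rightarrow> real^'n \<Rightarrow> (real^'d) set" where
  "poly_Q A b = {x. A *v x \<le> b}"

definition poly_G :: "real^'d^'n \<Rightarrow> (real^'d) set set" where
  "poly_G A = range (poly_Q A) - {{}}"

definition poly_C :: "real^'d^'n \<Rightarrow> (real^'n) set" where
  "poly_C A = {b. \<forall>i. \<exists>x \<in> poly_Q A b. row i A \<bullet> x = b $ i}"

text \<open>The sets may be unbounded, so the suprema are taken in \<open>[0, \<infinity>]\<close>.\<close>

definition excess :: "'a::metric_space set \<Rightarrow> 'a set \<Rightarrow> ennreal" where
  "excess S T = (SUP s\<in>S. INF t\<in>T. ennreal (dist s t))"

definition hausdorff_edist :: "'a::metric_space set \<Rightarrow> 'a set \<Rightarrow> ennreal" where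
  "hausdorff_edist S T = max (excess S T) (excess T S)"

text \<open>The real-valued version required by \<^locale>\<open>Metric_space\<close>. It is only meaningful
  where \<^const>\<open>hausdorff_edist\<close> is finite, since \<^const>\<open>enn2real\<close> maps \<open>\<infinity>\<close> to \<open>0\<close>.\<close>

definition hausdorff_dist :: "'a::metric_space set \<Rightarrow> 'a set \<Rightarrow> real" where
  "hausdorff_dist S T = enn2real (hausdorff_edist S T)"

text \<open>On \<^typ>\<open>real^'n\<close>, \<^const>\<open>infnorm\<close> is the maximum norm, whereas the
  type class metric is Euclidean.\<close>

definition infdistance :: "real^'n \<Rightarrow> real^'n \<Rightarrow> real" where
  "infdistance b c = infnorm (b - c)"

definition hoffman_constant :: "real^'d^'n \<Rightarrow> real \<Rightarrow> bool" where
  "hoffman_constant A L \<longleftrightarrow> L \<ge> 0 \<and>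
     (\<forall>x b. poly_Q A b \<noteq> {} \<longrightarrow>
        infdist x (poly_Q A b) \<le> L * infnorm (\<chi> i. max 0 ((A *v x - b) $ i)))"

end

theory Submission
  imports Defs
begin

text \<open>
  A right-hand side \<open>b\<close> lies in \<^term>\<open>poly_C A\<close> exactly when every constraint is tight
  somewhere on the polyhedron, that is, when \<open>b\<close> lists the support values
  \<open>b\<^sub>i = max {a\<^sub>i \<bullet> x | x \<in> Q}\<close>. The polyhedron therefore determines \<open>b\<close>. Conversely, every
  nonempty polyhedron \<open>Q\<close> with normals \<open>a\<^sub>i\<close> arises from its vector of support values, because a
  linear functional that is bounded above on a polyhedron attains its maximum
  (\<open>linear_program_attains_max\<close>).

  The two Lipschitz bounds carry the rest. Hoffman's error bound gives
  \<open>dist_H(Q(b), Q(c)) \<le> L \<parallel>b - c\<parallel>\<close>, since a point of \<open>Q(b)\<close> violates the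
  constraints of \<open>Q(c)\<close> by at most \<open>\<parallel>b - c\<parallel>\<close>. In the other direction, support values in a
  unit direction cannot differ by more than the Hausdorff distance, so
  \<open>\<parallel>b - c\<parallel> \<le> dist_H(Q(b), Q(c))\<close>. The first bound also makes the Hausdorff distance finite
  on \<^term>\<open>poly_G A\<close>, even for unbounded polyhedra, and the second makes it separate points;
  together they give continuity in both directions.
\<close>

section \<open>The Hausdorff distance between unbounded sets\<close>

lemma INF_ennreal_dist_eq_infdist:
  fixes T :: "'a::metric_space set"
  assumes "T \<noteq> {}"
  shows "(INF t\<in>T. ennreal (dist s t)) = ennreal (infdist s T)"
proof (rule antisym)
  show "ennreal (infdist s T) \<le> (INF t\<in>T. ennreal (dist s t))"
    by (intro INF_greatest ennreal_leI infdist_le)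
  show "(INF t\<in>T. ennreal (dist s t)) \<le> ennreal (infdist s T)"
  proof (rule ennreal_le_epsilon)
    fix e :: real assume "0 < e"
    then have "(INF t\<in>T. dist s t) < infdist s T + e"
      using assms by (simp add: infdist_def)
    then obtain t where "t \<in> T" "dist s t < infdist s T + e"
      using assms by (auto simp: cINF_less_iff)
    then have "(INF t\<in>T. ennreal (dist s t)) \<le> ennreal (infdist s T + e)"
      by (intro INF_lower2[of t] ennreal_leI) auto
    then show "(INF t\<in>T. ennreal (dist s t)) \<le> ennreal (infdist s T) + ennreal e"
      using \<open>0 < e\<close> by (simp add: infdist_nonneg)
  qed
qed

text \<open>Every bound on a Hausdorff distance below is proved or used pointwise through this
  characterisation.\<close>

lemma hausdorff_edist_le_ennreal_iff:
  assumes "S \<noteq> {}" "T \<noteq> {}" "0 \<le> r"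
  shows "hausdorff_edist S T \<le> ennreal r \<longleftrightarrow>
    (\<forall>s\<in>S. infdist s T \<le> r) \<and> (\<forall>t\<in>T. infdist t S \<le> r)"
  using assms
  by (simp add: hausdorff_edist_def excess_def INF_ennreal_dist_eq_infdist SUP_le_iff)

lemma hausdorff_dist_leI:
  assumes "S \<noteq> {}" "T \<noteq> {}" "0 \<le> r"
    and "\<And>s. s \<in> S \<Longrightarrow> infdist s T \<le> r" "\<And>t. t \<in> T \<Longrightarrow> infdist t S \<le> r"
  shows "hausdorff_dist S T \<le> r"
proof -
  have "hausdorff_edist S T \<le> ennreal r"
    using assms by (simp add: hausdorff_edist_le_ennreal_iff)
  then show ?thesis
    using \<open>0 \<le> r\<close> by (simp add: hausdorff_dist_def enn2real_leI)
qed

lemma infdist_le_hausdorff_dist: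
  assumes "T \<noteq> {}" "s \<in> S" "hausdorff_edist S T < \<infinity>"
  shows "infdist s T \<le> hausdorff_dist S T"
proof -
  have "hausdorff_edist S T \<le> ennreal (hausdorff_dist S T)"
    using assms by (simp add: hausdorff_dist_def)
  moreover have "S \<noteq> {}" "0 \<le> hausdorff_dist S T"
    using assms by (auto simp: hausdorff_dist_def)
  ultimately show ?thesis
    using assms hausdorff_edist_le_ennreal_iff by blast
qed

lemma hausdorff_edist_commute: "hausdorff_edist S T = hausdorff_edist T S"
  by (simp add: hausdorff_edist_def max.commute)

lemma hausdorff_dist_commute: "hausdorff_dist S T = hausdorff_dist T S"
  by (simp add: hausdorff_dist_def hausdorff_edist_commute)

lemma hausdorff_dist_nonneg: "0 \<le> hausdorff_dist S T"
  by (simp add: hausdorff_dist_def)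

lemma hausdorff_dist_self: "S \<noteq> {} \<Longrightarrow> hausdorff_dist S S = 0"
  by (intro antisym hausdorff_dist_leI hausdorff_dist_nonneg) auto

text \<open>No nearest point needs to exist in \<open>T\<close>, so the usual triangle inequality through a point
  \<open>t\<close> is applied for every \<open>t \<in> T\<close> before the infimum is taken.\<close>

lemma infdist_le_add_of_uniform_bound:
  fixes T :: "'a::metric_space set"
  assumes "T \<noteq> {}" and bound: "\<And>t. t \<in> T \<Longrightarrow> infdist t U \<le> r"
  shows "infdist s U \<le> infdist s T + r"
proof -
  have "infdist s U - r \<le> dist s t" if "t \<in> T" for t
    using infdist_triangle[of s U t] bound[OF that] by simp
  then have "infdist s U - r \<le> infdist s T"
    using \<open>T \<noteq> {}\<close> by (simp add: infdist_notempty cINF_greatest)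
  then show ?thesis by simp
qed

lemma hausdorff_dist_triangle:
  assumes ne: "S \<noteq> {}" "T \<noteq> {}" "U \<noteq> {}"
    and ST: "hausdorff_edist S T < \<infinity>" and TU: "hausdorff_edist T U < \<infinity>"
  shows "hausdorff_dist S U \<le> hausdorff_dist S T + hausdorff_dist T U"
proof (rule hausdorff_dist_leI)
  have TS: "hausdorff_edist T S < \<infinity>" and UT: "hausdorff_edist U T < \<infinity>"
    using ST TU by (simp_all add: hausdorff_edist_commute)
  show "infdist s U \<le> hausdorff_dist S T + hausdorff_dist T U" if "s \<in> S" for s
    using infdist_le_add_of_uniform_bound[of T U "hausdorff_dist T U" s]
      infdist_le_hausdorff_dist[OF ne(2) that ST] infdist_le_hausdorff_dist[OF ne(3) _ TU] ne
    by force
  show "infdist u S \<le> hausdorff_dist S T + hausdorff_dist T U" if "u \<in> U" for u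
    using infdist_le_add_of_uniform_bound[of T S "hausdorff_dist T S" u]
      infdist_le_hausdorff_dist[OF ne(2) that UT] infdist_le_hausdorff_dist[OF ne(1) _ TS] ne
    by (force simp: hausdorff_dist_commute)
qed (use ne in \<open>auto simp: hausdorff_dist_nonneg\<close>)

section \<open>The maximum norm\<close>

lemma infnorm_cart_le_iff:
  fixes x :: "real^'n"
  shows "infnorm x \<le> r \<longleftrightarrow> (\<forall>i. \<bar>x $ i\<bar> \<le> r)"
proof
  show "infnorm x \<le> r \<Longrightarrow> \<forall>i. \<bar>x $ i\<bar> \<le> r"
    using component_le_infnorm_cart order_trans by blast
  show "\<forall>i. \<bar>x $ i\<bar> \<le> r \<Longrightarrow> infnorm x \<le> r"
    by (auto simp: infnorm_cart intro!: cSup_least)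
qed

lemma Metric_space_infdistance: "Metric_space M infdistance"
proof
  fix x y z :: "real^'n"
  show "infdistance x z \<le> infdistance x y + infdistance y z"
    using infnorm_triangle[of "x - y" "y - z"] by (simp add: infdistance_def)
qed (auto simp: infdistance_def infnorm_pos_le infnorm_sub infnorm_eq_0)

section \<open>Support values of polyhedra\<close>

lemma mem_poly_Q_iff: "x \<in> poly_Q A b \<longleftrightarrow> (\<forall>i. row i A \<bullet> x \<le> b $ i)"
  by (simp add: poly_Q_def less_eq_vec_def matrix_vector_mul_component row_def inner_vec_def)

text \<open>Call a point \<open>y\<close> of a polyhedron critical for \<open>c\<close> if \<open>c\<close> vanishes on all directions
  that keep the active constraints of \<open>y\<close> active. From a point that is not critical one can move
  in a direction increasing \<open>c\<close>; since \<open>c\<close> is bounded, the move is stopped by a further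
  constraint becoming active. The number of inactive
  constraints drops with every move, so the process ends at a critical point.\<close>

lemma exists_critical_point_above:
  fixes a :: "'n::finite \<Rightarrow> 'a::real_inner"
  assumes bdd: "\<And>z. \<forall>i. a i \<bullet> z \<le> b i \<Longrightarrow> c \<bullet> z \<le> M"
    and "\<forall>i. a i \<bullet> x \<le> b i"
  shows "\<exists>y. (\<forall>i. a i \<bullet> y \<le> b i) \<and> c \<bullet> x \<le> c \<bullet> y \<and>
    (\<forall>d. (\<forall>i. a i \<bullet> y = b i \<longrightarrow> a i \<bullet> d = 0) \<longrightarrow> c \<bullet> d = 0)"
  using assms(2)
proof (induction "card {i. a i \<bullet> x < b i}" arbitrary: x rule: less_induct)
  case less
  show ?case
  proof (cases "\<forall>d. (\<forall>i. a i \<bullet> x = b i \<longrightarrow> a i \<bullet> d = 0) \<longrightarrow> c \<bullet> d = 0")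
    case True
    then show ?thesis using less.prems by blast
  next
    case False
    then obtain d' where d': "\<And>i. a i \<bullet> x = b i \<Longrightarrow> a i \<bullet> d' = 0" "c \<bullet> d' \<noteq> 0"
      by blast
    define d where "d = sgn (c \<bullet> d') *\<^sub>R d'"
    have d_active: "a i \<bullet> d = 0" if "a i \<bullet> x = b i" for i
      using d'(1)[OF that] by (simp add: d_def)
    have cd: "0 < c \<bullet> d"
      using d'(2) by (simp add: d_def sgn_if)
    define J where "J = {i. 0 < a i \<bullet> d}"
    have "J \<noteq> {}"
    proof
      assume "J = {}"
      \<comment> \<open>then the whole ray along \<open>d\<close> is feasible, and this point of it lies above the bound \<open>M\<close>\<close>
      define t where "t = (\<bar>M - c \<bullet> x\<bar> + 1) / (c \<bullet> d)"
      have "0 \<le> t"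
        using cd by (simp add: t_def)
      then have "t * (a i \<bullet> d) \<le> 0" for i
        using \<open>J = {}\<close> by (intro mult_nonneg_nonpos) (auto simp: J_def not_less)
      then have "\<forall>i. a i \<bullet> (x + t *\<^sub>R d) \<le> b i"
        using less.prems by (simp add: inner_add_right) (metis add.right_neutral add_mono)
      then have "c \<bullet> (x + t *\<^sub>R d) \<le> M"
        by (rule bdd)
      moreover have "c \<bullet> (x + t *\<^sub>R d) = c \<bullet> x + \<bar>M - c \<bullet> x\<bar> + 1"
        using cd by (simp add: inner_add_right t_def)
      ultimately show False by linarith
    qed
    \<comment> \<open>the largest step along \<open>d\<close> that stays feasible, limited by the constraint \<open>j\<close>\<close>
    define step where "step i = (b i - a i \<bullet> x) / (a i \<bullet> d)" for i
    obtain j where j: "j \<in> J" "\<And>i. i \<in> J \<Longrightarrow> step j \<le> step i"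
      using \<open>J \<noteq> {}\<close> ex_min_if_finite[of "step ` J"] by (auto simp: not_less)
    have step_nonneg: "0 \<le> step j"
      using j(1) less.prems by (simp add: step_def J_def)
    define y where "y = x + step j *\<^sub>R d"
    have ay: "a i \<bullet> y = a i \<bullet> x + step j * (a i \<bullet> d)" for i
      by (simp add: y_def inner_add_right)
    have feasible: "\<forall>i. a i \<bullet> y \<le> b i"
    proof
      fix i
      show "a i \<bullet> y \<le> b i"
      proof (cases "i \<in> J")
        case True
        then have "step j * (a i \<bullet> d) \<le> step i * (a i \<bullet> d)"
          using j(2) by (intro mult_right_mono) (auto simp: J_def)
        also have "\<dots> = b i - a i \<bullet> x"
          using True by (simp add: step_def J_def)
        finally show ?thesis by (simp add: ay)
      next
        case False
        then have "step j * (a i \<bullet> d) \<le> 0"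
          using step_nonneg by (intro mult_nonneg_nonpos) (auto simp: J_def)
        then show ?thesis
          using less.prems[rule_format, of i] by (simp add: ay)
      qed
    qed
    have "a j \<bullet> y = b j" "a j \<bullet> x < b j"
      using j(1) d_active[of j] less.prems[rule_format, of j]
      by (auto simp: ay step_def J_def order_le_less)
    moreover have "a i \<bullet> y = b i" if "a i \<bullet> x = b i" for i
      using that d_active by (simp add: ay)
    moreover have "a i \<bullet> x < b i" if "a i \<bullet> y < b i" for i
      using that \<open>a i \<bullet> x = b i \<Longrightarrow> a i \<bullet> y = b i\<close> less.prems[rule_format, of i]
      by (cases "a i \<bullet> x = b i") simp_all
    ultimately have "{i. a i \<bullet> y < b i} \<subset> {i. a i \<bullet> x < b i}"
      by (auto simp: psubset_eq set_eq_iff intro!: exI[of _ j])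
    then have "card {i. a i \<bullet> y < b i} < card {i. a i \<bullet> x < b i}"
      by (intro psubset_card_mono) auto
    from less.hyps[OF this feasible] obtain z where
      "\<forall>i. a i \<bullet> z \<le> b i" "c \<bullet> y \<le> c \<bullet> z"
      "\<forall>d. (\<forall>i. a i \<bullet> z = b i \<longrightarrow> a i \<bullet> d = 0) \<longrightarrow> c \<bullet> d = 0"
      by blast
    moreover have "c \<bullet> x \<le> c \<bullet> y"
      using cd step_nonneg by (simp add: y_def inner_add_right)
    ultimately show ?thesis
      by (meson order_trans)
  qed
qed

text \<open>The polyhedron may be unbounded, so compactness is of no help. Instead, the value of \<open>c\<close>
  at a critical point depends only on the set of active constraints; there are finitely many such
  sets, and the largest of the corresponding values is the maximum.\<close>

lemma linear_program_attains_max: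
  fixes a :: "'n::finite \<Rightarrow> 'a::real_inner"
  assumes bdd: "\<And>z. \<forall>i. a i \<bullet> z \<le> b i \<Longrightarrow> c \<bullet> z \<le> M"
    and feasible: "\<forall>i. a i \<bullet> x \<le> b i"
  shows "\<exists>y. (\<forall>i. a i \<bullet> y \<le> b i) \<and> (\<forall>z. (\<forall>i. a i \<bullet> z \<le> b i) \<longrightarrow> c \<bullet> z \<le> c \<bullet> y)"
proof -
  define act where "act y = {i. a i \<bullet> y = b i}" for y
  define V where "V = {y. (\<forall>i. a i \<bullet> y \<le> b i) \<and>
    (\<forall>d. (\<forall>i. a i \<bullet> y = b i \<longrightarrow> a i \<bullet> d = 0) \<longrightarrow> c \<bullet> d = 0)}"
  have above: "\<exists>y\<in>V. c \<bullet> z \<le> c \<bullet> y" if "\<forall>i. a i \<bullet> z \<le> b i" for z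
    using exists_critical_point_above[OF bdd that] by (auto simp: V_def)
  have same_value: "c \<bullet> y = c \<bullet> z" if "y \<in> V" "act y = act z" for y z
  proof -
    have "a i \<bullet> (y - z) = 0" if "a i \<bullet> y = b i" for i
    proof -
      have "i \<in> act z"
        using that unfolding \<open>act y = act z\<close>[symmetric] by (simp add: act_def)
      then have "a i \<bullet> z = b i"
        by (simp add: act_def)
      then show ?thesis
        using that by (simp add: inner_diff_right)
    qed
    then have "c \<bullet> (y - z) = 0"
      using \<open>y \<in> V\<close> by (auto simp: V_def)
    then show ?thesis by (simp add: inner_diff_right)
  qed
  have "(\<lambda>y. c \<bullet> y) ` V \<subseteq> (\<lambda>I. c \<bullet> inv_into V act I) ` UNIV"
  proof
    fix v assume "v \<in> (\<lambda>y. c \<bullet> y) ` V"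
    then obtain y where y: "y \<in> V" "v = c \<bullet> y"
      by blast
    then have "act y = act (inv_into V act (act y))"
      by (simp add: f_inv_into_f)
    then have "v = c \<bullet> inv_into V act (act y)"
      using y same_value by blast
    then show "v \<in> (\<lambda>I. c \<bullet> inv_into V act I) ` UNIV"
      by simp
  qed
  then have "finite ((\<lambda>y. c \<bullet> y) ` V)"
    by (rule finite_subset) simp
  moreover have "V \<noteq> {}"
    using above[OF feasible] by blast
  ultimately have "Max ((\<lambda>y. c \<bullet> y) ` V) \<in> (\<lambda>y. c \<bullet> y) ` V"
    by (intro Max_in) auto
  then obtain y where y: "y \<in> V" and "c \<bullet> y = Max ((\<lambda>y. c \<bullet> y) ` V)"
    by auto
  then have max: "c \<bullet> z \<le> c \<bullet> y" if "z \<in> V" for z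
    using that \<open>finite ((\<lambda>y. c \<bullet> y) ` V)\<close> by simp
  show ?thesis
  proof (intro exI[of _ y] conjI allI impI)
    fix z assume "\<forall>i. a i \<bullet> z \<le> b i"
    then show "c \<bullet> z \<le> c \<bullet> y"
      using above max order_trans by blast
  qed (use y in \<open>simp add: V_def\<close>)
qed

lemma poly_Q_nonempty_of_poly_C: "b \<in> poly_C A \<Longrightarrow> poly_Q A b \<noteq> {}"
  by (auto simp: poly_C_def)

lemma poly_Q_inner_attains_max:
  assumes "poly_Q A b \<noteq> {}"
  shows "\<exists>y\<in>poly_Q A b. \<forall>x\<in>poly_Q A b. row i A \<bullet> x \<le> row i A \<bullet> y"
proof -
  obtain x where "\<forall>i. row i A \<bullet> x \<le> b $ i"
    using assms by (auto simp: mem_poly_Q_iff)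
  then obtain y where "\<forall>j. row j A \<bullet> y \<le> b $ j"
      "\<forall>z. (\<forall>j. row j A \<bullet> z \<le> b $ j) \<longrightarrow> row i A \<bullet> z \<le> row i A \<bullet> y"
    using linear_program_attains_max[of "\<lambda>j. row j A" "\<lambda>j. b $ j" "row i A" "b $ i"] by blast
  then show ?thesis
    by (intro bexI[of _ y] ballI) (simp_all add: mem_poly_Q_iff)
qed

text \<open>Replacing the right-hand side by the attained support values makes all constraints tight
  without changing the polyhedron.\<close>

lemma poly_Q_image_poly_C: "poly_Q A ` poly_C A = poly_G A"
proof
  show "poly_Q A ` poly_C A \<subseteq> poly_G A"
    by (auto simp: poly_G_def dest: poly_Q_nonempty_of_poly_C)
  show "poly_G A \<subseteq> poly_Q A ` poly_C A"
  proof
    fix P assume "P \<in> poly_G A"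
    then obtain b where P: "P = poly_Q A b" and ne: "poly_Q A b \<noteq> {}"
      by (auto simp: poly_G_def)
    obtain y where y: "\<And>i. y i \<in> poly_Q A b"
        and max: "\<And>i x. x \<in> poly_Q A b \<Longrightarrow> row i A \<bullet> x \<le> row i A \<bullet> y i"
      using poly_Q_inner_attains_max[OF ne] by metis
    define c where "c = (\<chi> i. row i A \<bullet> y i)"
    have attained: "\<exists>x\<in>poly_Q A b. row i A \<bullet> x = c $ i" for i
      using y by (auto simp: c_def)
    have "c $ i \<le> b $ i" for i
      using y by (auto simp: c_def mem_poly_Q_iff)
    then have "x \<in> poly_Q A b" if "x \<in> poly_Q A c" for x
      using that by (meson mem_poly_Q_iff order_trans)
    moreover have "x \<in> poly_Q A c" if "x \<in> poly_Q A b" for x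
      using max that by (simp add: mem_poly_Q_iff c_def)
    ultimately have "poly_Q A c = poly_Q A b"
      by blast
    then show "P \<in> poly_Q A ` poly_C A"
      using attained P by (auto simp: poly_C_def)
  qed
qed

lemma inj_on_poly_Q_poly_C: "inj_on (poly_Q A) (poly_C A)"
proof -
  have "b $ i \<le> c $ i" if b: "b \<in> poly_C A" and eq: "poly_Q A b = poly_Q A c" for b c i
  proof -
    obtain x where x: "x \<in> poly_Q A b" "row i A \<bullet> x = b $ i"
      using b by (auto simp: poly_C_def)
    have "row i A \<bullet> x \<le> c $ i"
      using x(1) by (simp add: eq mem_poly_Q_iff)
    then show ?thesis by (simp add: x(2))
  qed
  then show ?thesis
    by (intro inj_onI) (simp add: vec_eq_iff order_antisym)
qed

lemma bij_betw_poly_Q: "bij_betw (poly_Q A) (poly_C A) (poly_G A)"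
  by (simp add: bij_betw_def inj_on_poly_Q_poly_C poly_Q_image_poly_C)

section \<open>The two Lipschitz bounds\<close>

text \<open>A point of \<open>Q(b)\<close> exceeds the \<open>i\<close>th constraint of \<open>Q(c)\<close> by at most
  \<open>max 0 (b\<^sub>i - c\<^sub>i)\<close>.\<close>

lemma infdist_poly_Q_le:
  assumes hoffman: "hoffman_constant A L"
    and x: "x \<in> poly_Q A b" and ne: "poly_Q A c \<noteq> {}"
  shows "infdist x (poly_Q A c) \<le> L * infdistance b c"
proof -
  have "\<bar>max 0 ((A *v x - c) $ i)\<bar> \<le> infdistance b c" for i
  proof -
    have "(A *v x) $ i \<le> b $ i"
      using x by (simp add: poly_Q_def less_eq_vec_def)
    then show ?thesis
      using component_le_infnorm_cart[of "b - c" i] infnorm_pos_le[of "b - c"]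
      by (simp add: infdistance_def)
  qed
  then have "infnorm (\<chi> i. max 0 ((A *v x - c) $ i)) \<le> infdistance b c"
    by (simp add: infnorm_cart_le_iff)
  then have "L * infnorm (\<chi> i. max 0 ((A *v x - c) $ i)) \<le> L * infdistance b c"
    using hoffman by (intro mult_left_mono) (auto simp: hoffman_constant_def)
  moreover have "infdist x (poly_Q A c) \<le> L * infnorm (\<chi> i. max 0 ((A *v x - c) $ i))"
    using hoffman ne by (auto simp: hoffman_constant_def)
  ultimately show ?thesis by linarith
qed

lemma hausdorff_edist_poly_Q_le:
  assumes hoffman: "hoffman_constant A L"
    and ne: "poly_Q A b \<noteq> {}" "poly_Q A c \<noteq> {}"
  shows "hausdorff_edist (poly_Q A b) (poly_Q A c) \<le> ennreal (L * infdistance b c)"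
proof -
  have "infdistance c b = infdistance b c"
    by (simp add: infdistance_def infnorm_sub)
  moreover have "0 \<le> L * infdistance b c"
    using hoffman by (simp add: hoffman_constant_def infdistance_def infnorm_pos_le)
  ultimately show ?thesis
    using ne infdist_poly_Q_le[OF hoffman, of _ b c] infdist_poly_Q_le[OF hoffman, of _ c b]
    by (simp add: hausdorff_edist_le_ennreal_iff)
qed

lemma hausdorff_dist_poly_Q_le:
  assumes "hoffman_constant A L" "poly_Q A b \<noteq> {}" "poly_Q A c \<noteq> {}"
  shows "hausdorff_dist (poly_Q A b) (poly_Q A c) \<le> L * infdistance b c"
  using hausdorff_edist_poly_Q_le[OF assms] assms(1)
  by (simp add: hausdorff_dist_def enn2real_leI hoffman_constant_def infdistance_def
      infnorm_pos_le)

text \<open>If \<open>x \<in> Q(b)\<close> makes the \<open>i\<close>th constraint tight, then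
  \<open>b\<^sub>i - c\<^sub>i \<le> a\<^sub>i \<bullet> (x - y) \<le> \<parallel>x - y\<parallel>\<close> for all \<open>y \<in> Q(c)\<close>, by Cauchy-Schwarz.\<close>

lemma support_value_diff_le_hausdorff_dist:
  assumes unit: "norm (row i A) = 1"
    and b: "b \<in> poly_C A" and ne: "poly_Q A c \<noteq> {}"
    and fin: "hausdorff_edist (poly_Q A b) (poly_Q A c) < \<infinity>"
  shows "b $ i - c $ i \<le> hausdorff_dist (poly_Q A b) (poly_Q A c)"
proof -
  obtain x where x: "x \<in> poly_Q A b" "row i A \<bullet> x = b $ i"
    using b by (auto simp: poly_C_def)
  have "b $ i - c $ i \<le> dist x y" if "y \<in> poly_Q A c" for y
  proof -
    have "b $ i - c $ i \<le> row i A \<bullet> (x - y)"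
      using that x by (simp add: mem_poly_Q_iff inner_diff_right)
    also have "\<dots> \<le> dist x y"
      using norm_cauchy_schwarz[of "row i A" "x - y"] unit by (simp add: dist_norm)
    finally show ?thesis .
  qed
  then have "b $ i - c $ i \<le> infdist x (poly_Q A c)"
    using ne by (auto simp: infdist_def intro!: cINF_greatest)
  then show ?thesis
    using infdist_le_hausdorff_dist[OF ne x(1) fin] by linarith
qed

lemma infdistance_le_hausdorff_dist:
  assumes unit: "\<And>i. norm (row i A) = 1"
    and b: "b \<in> poly_C A" and c: "c \<in> poly_C A"
    and fin: "hausdorff_edist (poly_Q A b) (poly_Q A c) < \<infinity>"
  shows "infdistance b c \<le> hausdorff_dist (poly_Q A b) (poly_Q A c)"
  using support_value_diff_le_hausdorff_dist[OF unit b poly_Q_nonempty_of_poly_C[OF c] fin]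
    support_value_diff_le_hausdorff_dist[OF unit c poly_Q_nonempty_of_poly_C[OF b]] fin
  by (auto simp: infdistance_def infnorm_cart_le_iff abs_le_iff hausdorff_edist_commute
      hausdorff_dist_commute)

section \<open>Continuity of Lipschitz maps\<close>

lemma (in Metric_space12) continuous_map_of_Lipschitz:
  assumes maps: "f \<in> M1 \<rightarrow> M2"
    and lip: "\<And>x y. \<lbrakk>x \<in> M1; y \<in> M1\<rbrakk> \<Longrightarrow> d2 (f x) (f y) \<le> K * d1 x y"
  shows "continuous_map M1.mtopology M2.mtopology f"
proof -
  have "Lipschitz_continuous_map (metric (M1, d1)) (metric (M2, d2)) f"
    using maps lip by (auto simp: Lipschitz_continuous_map_def)
  from Lipschitz_continuous_imp_continuous_map[OF this] show ?thesis
    by (simp add: mtopology_of_def)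
qed

section \<open>The homeomorphism\<close>

theorem theorem12:
  fixes A :: "real^'d^'n" and L :: real
  assumes rows_distinct: "inj (\<lambda>i. row i A)"
    and rows_unit: "\<And>i. norm (row i A) = 1"
    and hoffman: "hoffman_constant A L"
  shows "Metric_space (poly_C A) infdistance
    \<and> (\<forall>P \<in> poly_G A. \<forall>P' \<in> poly_G A. hausdorff_edist P P' < \<infinity>)
    \<and> Metric_space (poly_G A) hausdorff_dist
    \<and> bij_betw (poly_Q A) (poly_C A) (poly_G A)
    \<and> homeomorphic_maps (Metric_space.mtopology (poly_C A) infdistance)
                        (Metric_space.mtopology (poly_G A) hausdorff_dist)
                        (poly_Q A) (inv_into (poly_C A) (poly_Q A))
    \<and> (\<forall>b \<in> poly_C A. \<forall>b' \<in> poly_C A.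
          hausdorff_dist (poly_Q A b) (poly_Q A b') \<le> L * infdistance b b')
    \<and> (\<forall>P \<in> poly_G A. \<forall>P' \<in> poly_G A.
          infdistance (inv_into (poly_C A) (poly_Q A) P) (inv_into (poly_C A) (poly_Q A) P')
            \<le> 1 * hausdorff_dist P P')"
proof -
  let ?C = "poly_C A" and ?G = "poly_G A" and ?inv = "inv_into (poly_C A) (poly_Q A)"
  note bij = bij_betw_poly_Q[of A]
  have inv_mem: "?inv P \<in> ?C" and Q_inv: "poly_Q A (?inv P) = P" if "P \<in> ?G" for P
    using that bij_betw_inv_into_right[OF bij] bij_betwE[OF bij_betw_inv_into[OF bij]] by auto
  have G_ne: "P \<noteq> {}" if "P \<in> ?G" for P
    using that by (simp add: poly_G_def)
  have fin: "hausdorff_edist P P' < \<infinity>" if P: "P \<in> ?G" "P' \<in> ?G" for P P'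
  proof -
    have "hausdorff_edist P P' \<le> ennreal (L * infdistance (?inv P) (?inv P'))"
      using hausdorff_edist_poly_Q_le[OF hoffman, of "?inv P" "?inv P'"] Q_inv G_ne P by simp
    also have "\<dots> < \<infinity>"
      by simp
    finally show ?thesis .
  qed
  have lip: "hausdorff_dist (poly_Q A b) (poly_Q A b') \<le> L * infdistance b b'"
    if "b \<in> ?C" "b' \<in> ?C" for b b'
    using that by (intro hausdorff_dist_poly_Q_le hoffman poly_Q_nonempty_of_poly_C)
  have lip_inv: "infdistance (?inv P) (?inv P') \<le> 1 * hausdorff_dist P P'"
    if "P \<in> ?G" "P' \<in> ?G" for P P'
    using infdistance_le_hausdorff_dist[OF rows_unit, of "?inv P" "?inv P'"]
      inv_mem Q_inv fin that by simp
  have metric_C: "Metric_space ?C infdistance"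
    by (rule Metric_space_infdistance)
  have metric_G: "Metric_space ?G hausdorff_dist"
  proof
    fix P P' assume P: "P \<in> ?G" "P' \<in> ?G"
    show "hausdorff_dist P P' = 0 \<longleftrightarrow> P = P'"
    proof
      assume "hausdorff_dist P P' = 0"
      then have "infdistance (?inv P) (?inv P') = 0"
        using lip_inv[OF P] infnorm_pos_le[of "?inv P - ?inv P'"] by (simp add: infdistance_def)
      then have "?inv P = ?inv P'"
        by (simp add: infdistance_def infnorm_eq_0)
      then show "P = P'"
        using Q_inv P by metis
    qed (use P G_ne hausdorff_dist_self in auto)
  next
    fix P P' P'' assume "P \<in> ?G" "P' \<in> ?G" "P'' \<in> ?G"
    then show "hausdorff_dist P P'' \<le> hausdorff_dist P P' + hausdorff_dist P' P''"
      by (intro hausdorff_dist_triangle G_ne fin)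
  qed (simp_all add: hausdorff_dist_nonneg hausdorff_dist_commute)
  interpret CG: Metric_space12 ?C infdistance ?G hausdorff_dist
    using metric_C metric_G by (simp add: Metric_space12_def)
  interpret GC: Metric_space12 ?G hausdorff_dist ?C infdistance
    using metric_C metric_G by (simp add: Metric_space12_def)
  have "continuous_map CG.M1.mtopology CG.M2.mtopology (poly_Q A)"
    using lip bij_betwE[OF bij] by (intro CG.continuous_map_of_Lipschitz) auto
  moreover have "continuous_map CG.M2.mtopology CG.M1.mtopology ?inv"
    using lip_inv inv_mem by (intro GC.continuous_map_of_Lipschitz[where K = 1]) auto
  ultimately have "homeomorphic_maps CG.M1.mtopology CG.M2.mtopology (poly_Q A) ?inv"
    using bij_betw_inv_into_left[OF bij] Q_inv by (simp add: homeomorphic_maps_def)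
  then show ?thesis
    using metric_C metric_G fin bij lip lip_inv by blast
qed

end
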